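(* Let $G$ be a finite SIP group. Then $G$ is not simple.
   Context: A group $G$ is said to have the subgroup intersection property (is a SIP group) if there exists a proper subgroup $H$ of $G$ which intersects all non-trivial subgroups $X$ of $G$ non-trivially, i.e., $|X\cap H|>1$ for every non-trivial subgroup $X$ of $G$. *)

theory Defs
  imports "HOL-Algebra.SimpleGroups"
begin

(* The condition "card (X \<inter> H) > 1" is rendered as "X \<inter> H \<noteq> {\<one>}", since card is 0 on
   infinite sets; for subgroups both say that the intersection is non-trivial. *)
definition SIP :: "('a, 'b) monoid_scheme \<Rightarrow> bool" where
  "SIP G \<longleftrightarrow>
     (\<exists>H. subgroup H G \<and> H \<noteq> carrier G \<and>
          (\<forall>X. subgroup X G \<and> X \<noteq> {\<one>\<^bsub>G\<^esub>} \<longrightarrow> X \<inter> H \<noteq> {\<one>\<^bsub>G\<^esub>}))"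

end

theory Submission
  imports Defs "HOL-Algebra.Multiplicative_Group"
begin

text \<open>
  A subgroup that meets every non-trivial subgroup contains every element of prime order
  (\<open>prime_ord_mem_of_meets\<close>), because a group of prime order has no proper non-trivial
  subgroups. The subgroup generated by all elements of prime order is normal
  (\<open>normal_generate_prime_ord\<close>), since conjugation preserves orders, and in a non-trivial finite
  group it is non-trivial (\<open>exists_prime_ord\<close>). When a proper subgroup contains it, it is a
  proper non-trivial normal subgroup, so the group is not simple.
\<close>

context group
begin

lemma conj_nat_pow:
  assumes "g \<in> carrier G" "x \<in> carrier G"
  shows "(g \<otimes> x \<otimes> inv g) [^] (n::nat) = g \<otimes> x [^] n \<otimes> inv g"
proof (induction n)
  case 0
  then show ?case using assms by simp
next
  case (Suc n)
  have "inv g \<otimes> (g \<otimes> (x \<otimes> inv g)) = x \<otimes> inv g"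
    using assms m_assoc[of "inv g" g "x \<otimes> inv g"] by simp
  then have "g \<otimes> x [^] n \<otimes> inv g \<otimes> (g \<otimes> x \<otimes> inv g) = g \<otimes> x [^] Suc n \<otimes> inv g"
    using assms by (simp add: m_assoc)
  then show ?case using Suc by simp
qed

lemma ord_conj:
  assumes "g \<in> carrier G" "x \<in> carrier G"
  shows "ord (g \<otimes> x \<otimes> inv g) = ord x"
proof -
  have "(g \<otimes> x \<otimes> inv g) [^] n = \<one> \<longleftrightarrow> x [^] n = \<one>" for n :: nat
  proof -
    have "g \<otimes> x [^] n \<otimes> inv g = \<one> \<longleftrightarrow> g \<otimes> x [^] n = g"
      using assms inv_solve_right'[of \<one> "g \<otimes> x [^] n" g] by auto
    also have "\<dots> \<longleftrightarrow> x [^] n = \<one>"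
      using assms by simp
    finally show ?thesis using conj_nat_pow assms by simp
  qed
  then show ?thesis
    using assms by (simp add: ord_unique pow_eq_id)
qed

lemma normal_generate_prime_ord:
  "generate G {x \<in> carrier G. prime (ord x)} \<lhd> G"
  by (rule normal_generateI) (auto simp: ord_conj)

lemma exists_prime_ord:
  assumes "finite (carrier G)" "carrier G \<noteq> {\<one>}"
  shows "\<exists>x \<in> carrier G. prime (ord x)"
proof -
  obtain y where y: "y \<in> carrier G" "y \<noteq> \<one>"
    using assms(2) one_closed by blast
  have "ord y \<noteq> 1" "ord y \<noteq> 0"
    using ord_eq_1 ord_ge_1[OF assms(1)] y by fastforce+
  then obtain p k where p: "prime p" "ord y = p * k"
    using prime_factor_nat by (meson dvdE)
  \<comment> \<open>Raising to the cofactor of \<open>p\<close> in the order leaves an element of order \<open>p\<close>.\<close>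
  have "ord (y [^] k) = p"
    using ord_pow[OF y(1), of k] p \<open>ord y \<noteq> 0\<close> by simp
  then show ?thesis using p y by auto
qed

text \<open>
  When \<open>x\<close> has prime order, by Lagrange any \<open>y \<noteq> \<one>\<close> in the cyclic group generated by \<open>x\<close> already generates that group,
  so a subgroup containing such a \<open>y\<close> contains \<open>x\<close>.
\<close>

lemma prime_ord_mem_of_meets:
  assumes H: "subgroup H G" and x: "x \<in> carrier G" "prime (ord x)"
    and meets: "generate G {x} \<inter> H \<noteq> {\<one>}"
  shows "x \<in> H"
proof -
  let ?X = "generate G {x}"
  have X: "subgroup ?X G" and card_X: "card ?X = ord x"
    using x generate_is_subgroup[of "{x}"] generate_pow_card[of x] by simp_all
  let ?Y = "?X \<inter> H"
  have Y: "subgroup ?Y G"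
    using subgroups_Inter_pair[OF X H] .
  have fin: "finite ?X"
    using card_X x(2) by (metis card.infinite not_prime_0)
  obtain y where y: "y \<in> ?Y" "y \<noteq> \<one>"
    using meets subgroup.one_closed[OF Y] by blast
  then have y_carrier: "y \<in> carrier G"
    using subgroup.mem_carrier[OF Y] by blast
  have sub: "generate G {y} \<subseteq> ?X"
    using generate_subgroup_incl[OF _ X, of "{y}"] y by simp
  have "ord y dvd ord x"
  proof -
    interpret X: group "G\<lparr>carrier := ?X\<rparr>" using X subgroup_imp_group by simp
    have "subgroup (generate G {y}) (G\<lparr>carrier := ?X\<rparr>)"
      using subgroup_incl[OF _ X sub] generate_is_subgroup[of "{y}"] y_carrier by simp
    from X.lagrange[OF this] have "card (generate G {y}) dvd card ?X"
      by (simp add: order_def) (metis dvd_triv_right)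
    then show ?thesis
      using card_X generate_pow_card[OF y_carrier] by simp
  qed
  moreover have "ord y \<noteq> 1"
    using ord_eq_1[OF y_carrier] y by simp
  ultimately have "ord y = ord x"
    using x(2) unfolding prime_nat_iff by blast
  then have "generate G {y} = ?X"
    using card_subset_eq[OF fin sub] card_X generate_pow_card[OF y_carrier] by simp
  then have "?X \<subseteq> H"
    using generate_subgroup_incl[OF _ H, of "{y}"] y by simp
  then show ?thesis using generate.incl[of x "{x}" G] by blast
qed

lemma not_simple_of_proper_meets:
  assumes fin: "finite (carrier G)" and H: "subgroup H G" "H \<noteq> carrier G"
    and meets: "\<And>X. subgroup X G \<Longrightarrow> X \<noteq> {\<one>} \<Longrightarrow> X \<inter> H \<noteq> {\<one>}"
  shows "\<not> simple_group G"
proof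
  assume "simple_group G"
  then interpret S: simple_group G .
  let ?S = "{x \<in> carrier G. prime (ord x)}"
  have nontrivial: "x \<in> A \<Longrightarrow> prime (ord x) \<Longrightarrow> generate G A \<noteq> {\<one>}" for x A
    using generate.incl[of x A G] ord_id by fastforce
  have "?S \<subseteq> H"
  proof
    fix x assume "x \<in> ?S"
    then have x: "x \<in> carrier G" "prime (ord x)" by simp_all
    then have "generate G {x} \<inter> H \<noteq> {\<one>}"
      using meets generate_is_subgroup[of "{x}"] nontrivial[of x "{x}"] by simp
    then show "x \<in> H" using prime_ord_mem_of_meets[OF H(1) x] by simp
  qed
  then have "generate G ?S \<subseteq> H"
    using generate_subgroup_incl H(1) by simp
  then have "generate G ?S \<noteq> carrier G"
    using H subgroup.subset[OF H(1)] by auto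
  moreover obtain x where "x \<in> ?S"
    using exists_prime_ord[OF fin S.simple_not_triv] by auto
  then have "generate G ?S \<noteq> {\<one>}"
    using nontrivial[of x ?S] by simp
  ultimately show False
    using S.no_real_normal_subgroup[OF normal_generate_prime_ord] by simp
qed

end

theorem proposition3p2:
  fixes G :: "('a, 'b) monoid_scheme"
  assumes "group G" and "finite (carrier G)" and "SIP G"
  shows "\<not> simple_group G"
  using group.not_simple_of_proper_meets[OF assms(1,2)] assms(3)
  unfolding SIP_def by blast

end
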